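(* Let $p$ be a prime, $X$ a countable set, and let $e\in\mathcal{K}(\mathbb{Q}_p(X))$ be an idempotent. Then the image of $e$ is a finite-dimensional $\mathbb{Q}_p$-vector space.
   Context: $\mathbb{Q}_p(X)$ is the set of maps $\xi:X\to\mathbb{Q}_p$ with $|\xi(i)|_p\le1$ for all but finitely many $i$, a $\mathbb{Z}_p$-module under coordinatewise operations, with the topology $\tau$ in which $A\subseteq\mathbb{Q}_p(X)$ is open iff for every finite $P\subseteq X$ the set $A\cap\big(\prod_{i\in P}\mathbb{Q}_p\times\prod_{j\in X\setminus P}\mathbb{Z}_p\big)$ is open in the product topology. $\mathcal{B}(\mathbb{Q}_p(X))$ is the algebra of $\tau$-continuous $\mathbb{Z}_p$-linear maps on $\mathbb{Q}_p(X)$; the norm on $\mathbb{Q}_p(X)$ is $\|\xi\|=\max_i|\xi(i)|_p$. $\mathcal{K}(\mathbb{Q}_p(X))$ is the set of operators in $\mathcal{B}(\mathbb{Q}_p(X))$ mapping norm-bounded sets onto relatively $\tau$-compact sets. *)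

theory Defs
  imports "HOL-Analysis.Analysis" "HOL-Computational_Algebra.Primes" "HOL-Library.Countable"
begin

definition padic_val_rat :: "nat \<Rightarrow> rat \<Rightarrow> int" where
  "padic_val_rat p q = (case quotient_of q of (a, b) \<Rightarrow>
      int (multiplicity (int p) a) - int (multiplicity (int p) b))"

definition padic_abs_rat :: "nat \<Rightarrow> rat \<Rightarrow> real" where
  "padic_abs_rat p q = (if q = 0 then 0 else real p powr (- real_of_int (padic_val_rat p q)))"

text \<open>A field 'k with absolute value av is (a model of) the p-adic numbers Q_p:
  a complete non-archimedean valued field extending Q with the p-adic absolute value,
  in which Q is dense (i.e. the completion of Q w.r.t. the p-adic absolute value).\<close>
definition is_Qp :: "nat \<Rightarrow> ('k::field_char_0 \<Rightarrow> real) \<Rightarrow> bool" where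
  "is_Qp p av \<longleftrightarrow>
     (\<forall>x. av x \<ge> 0) \<and> (\<forall>x. av x = 0 \<longleftrightarrow> x = 0) \<and>
     (\<forall>x y. av (x * y) = av x * av y) \<and>
     (\<forall>x y. av (x + y) \<le> max (av x) (av y)) \<and>
     (\<forall>q. av (of_rat q) = padic_abs_rat p q) \<and>
     (\<forall>x. \<forall>e>0. \<exists>q. av (x - of_rat q) < e) \<and>
     (\<forall>s::nat \<Rightarrow> 'k. (\<forall>e>0. \<exists>N. \<forall>m\<ge>N. \<forall>n\<ge>N. av (s m - s n) < e) \<longrightarrow>
        (\<exists>L. \<forall>e>0. \<exists>N. \<forall>n\<ge>N. av (s n - L) < e))"

definition Qp_top :: "('k::field_char_0 \<Rightarrow> real) \<Rightarrow> 'k topology" where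
  "Qp_top av = topology (\<lambda>U. \<forall>x\<in>U. \<exists>e>0. \<forall>y. av (y - x) < e \<longrightarrow> y \<in> U)"

definition QpX :: "('k::field_char_0 \<Rightarrow> real) \<Rightarrow> ('x \<Rightarrow> 'k) set" where
  "QpX av = {\<xi>. finite {i. av (\<xi> i) > 1}}"

definition box_set :: "('k::field_char_0 \<Rightarrow> real) \<Rightarrow> 'x set \<Rightarrow> ('x \<Rightarrow> 'k) set" where
  "box_set av P = {\<xi>. \<forall>j. j \<notin> P \<longrightarrow> av (\<xi> j) \<le> 1}"

definition tau :: "('k::field_char_0 \<Rightarrow> real) \<Rightarrow> ('x \<Rightarrow> 'k) topology" where
  "tau av = topology (\<lambda>A. A \<subseteq> QpX av \<and>
      (\<forall>P. finite P \<longrightarrow>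
         openin (subtopology (product_topology (\<lambda>i. Qp_top av) UNIV) (box_set av P))
                (A \<inter> box_set av P)))"

definition qnorm :: "('k::field_char_0 \<Rightarrow> real) \<Rightarrow> ('x \<Rightarrow> 'k) \<Rightarrow> real" where
  "qnorm av \<xi> = (SUP i. av (\<xi> i))"

definition bounded_ops :: "('k::field_char_0 \<Rightarrow> real) \<Rightarrow> (('x \<Rightarrow> 'k) \<Rightarrow> ('x \<Rightarrow> 'k)) set" where
  "bounded_ops av = {T. T ` QpX av \<subseteq> QpX av \<and>
      (\<forall>\<xi>\<in>QpX av. \<forall>\<eta>\<in>QpX av. T (\<lambda>i. \<xi> i + \<eta> i) = (\<lambda>i. T \<xi> i + T \<eta> i)) \<and>
      (\<forall>a. av a \<le> 1 \<longrightarrow> (\<forall>\<xi>\<in>QpX av. T (\<lambda>i. a * \<xi> i) = (\<lambda>i. a * T \<xi> i))) \<and>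
      continuous_map (tau av) (tau av) T}"

definition compact_ops :: "('k::field_char_0 \<Rightarrow> real) \<Rightarrow> (('x \<Rightarrow> 'k) \<Rightarrow> ('x \<Rightarrow> 'k)) set" where
  "compact_ops av = {T \<in> bounded_ops av.
      \<forall>B. B \<subseteq> QpX av \<and> (\<exists>M. \<forall>\<xi>\<in>B. qnorm av \<xi> \<le> M) \<longrightarrow>
          compactin (tau av) ((tau av) closure_of (T ` B))}"

end

theory Submission
  imports Defs
begin

text \<open>Let \<open>V\<close> be the image of \<open>e\<close> and \<open>B\<close> the unit ball. For a scalar \<open>r \<noteq> 0\<close> of absolute value
  at most 1, the finitely supported vectors in \<open>r\<^sup>-\<^sup>1 B\<close> are norm-bounded, so \<open>e\<close> maps them into a
  compact set, which lies in a single box \<open>box_set av P\<close>. Finitely supported vectors being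
  \<open>\<tau>\<close>-dense in \<open>B\<close>, all of \<open>e B\<close> lies in \<open>r\<close> times that box. As \<open>r\<close> is arbitrary, elements of \<open>V\<close>
  may be divided by \<open>r\<close> inside \<open>\<rat>\<^sub>p(X)\<close>, so \<open>V\<close> is a vector space. Taking \<open>r = p\<close>, an
  element of \<open>V \<inter> B\<close> vanishing on \<open>P\<close> is divisible by \<open>p\<close> in \<open>V \<inter> B\<close>, hence infinitely divisible, hence
  zero: restriction to the finite set \<open>P\<close> is injective on \<open>V\<close>.\<close>

section \<open>Linear algebra: subspaces determined by finitely many coordinates\<close>

text \<open>Induction on \<open>P\<close>: the elements of \<open>V\<close> that vanish at the new
  point \<open>a\<close> form a subspace determined by the remaining points, and at most one further
  vector \<open>w\<close>, with \<open>w a\<close> nonzero, is needed to span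
  \<open>V\<close>.\<close>

lemma finite_spanning_set_of_inj_restriction:
  fixes V :: "('x \<Rightarrow> 'k::field) set"
  assumes "finite P"
    and "\<And>v w. v \<in> V \<Longrightarrow> w \<in> V \<Longrightarrow> (\<lambda>i. v i + w i) \<in> V"
    and "\<And>c v. v \<in> V \<Longrightarrow> (\<lambda>i. c * v i) \<in> V"
    and "\<And>v. v \<in> V \<Longrightarrow> (\<forall>i\<in>P. v i = 0) \<Longrightarrow> \<forall>i. v i = 0"
  shows "\<exists>F. finite F \<and> F \<subseteq> V \<and> (\<forall>v\<in>V. \<exists>c. \<forall>i. v i = (\<Sum>f\<in>F. c f * f i))"
  using assms
proof (induction P arbitrary: V rule: finite_induct)
  case empty
  then show ?case by (intro exI[of _ "{}"]) auto
next
  case (insert a P)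
  define V' where "V' = {v \<in> V. v a = 0}"
  have "\<exists>F. finite F \<and> F \<subseteq> V' \<and> (\<forall>v\<in>V'. \<exists>c. \<forall>i. v i = (\<Sum>f\<in>F. c f * f i))"
    by (rule insert.IH) (use insert.prems in \<open>auto simp: V'_def\<close>)
  then obtain F where F: "finite F" "F \<subseteq> V'"
    and span: "\<And>v. v \<in> V' \<Longrightarrow> \<exists>c. \<forall>i. v i = (\<Sum>f\<in>F. c f * f i)" by blast
  show ?case
  proof (cases "V' = V")
    case True
    then show ?thesis using F span by (intro exI[of _ F]) blast
  next
    case False
    then obtain w where w: "w \<in> V" "w a \<noteq> 0" unfolding V'_def by blast
    then have wF: "w \<notin> F" using F unfolding V'_def by blast
    show ?thesis
    proof (intro exI[of _ "insert w F"] conjI ballI)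
      fix v assume v: "v \<in> V"
      \<comment> \<open>This is the multiple of \<open>w\<close> whose subtraction makes
        \<open>v\<close> vanish at \<open>a\<close>, so that the difference lies in
        \<open>V'\<close>.\<close>
      define d where "d = v a / w a"
      have "(\<lambda>i. v i + (- d) * w i) \<in> V"
        using insert.prems(1)[OF v insert.prems(2)[OF w(1)]] .
      then have "(\<lambda>i. v i + (- d) * w i) \<in> V'"
        using w by (simp add: V'_def d_def)
      then obtain c where c: "\<And>i. v i + (- d) * w i = (\<Sum>f\<in>F. c f * f i)"
        using span by blast
      have "v i = (\<Sum>f\<in>insert w F. (c(w := d)) f * f i)" for i
      proof -
        \<comment> \<open>Elements of \<open>F\<close> vanish at \<open>a\<close> and
          \<open>w\<close> does not, so changing \<open>c\<close> at \<open>w\<close> leaves the sum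
          over \<open>F\<close> alone.\<close>
        have "(\<Sum>f\<in>F. (c(w := d)) f * f i) = (\<Sum>f\<in>F. c f * f i)"
          using wF by (intro sum.cong) auto
        then show ?thesis using c[of i] F wF by (simp add: algebra_simps)
      qed
      then show "\<exists>c. \<forall>i. v i = (\<Sum>f\<in>insert w F. c f * f i)" by blast
    qed (use F w in \<open>auto simp: V'_def\<close>)
  qed
qed

section \<open>Non-archimedean absolute values\<close>

locale nonarch_abs =
  fixes av :: "'k::field_char_0 \<Rightarrow> real"
  assumes nonneg: "av x \<ge> 0"
    and eq_0_iff: "av x = 0 \<longleftrightarrow> x = 0"
    and mult: "av (x * y) = av x * av y"
    and ultra: "av (x + y) \<le> max (av x) (av y)"
begin

lemma av_0 [simp]: "av 0 = 0"
  by (simp add: eq_0_iff)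

lemma av_1 [simp]: "av 1 = 1"
  using mult[of 1 1] eq_0_iff[of 1] by simp

lemma av_pos: "x \<noteq> 0 \<Longrightarrow> av x > 0"
  using nonneg[of x] eq_0_iff[of x] by linarith

lemma av_inverse: "av (inverse x) = inverse (av x)"
proof (cases "x = 0")
  case False
  then have "av x * av (inverse x) = 1" by (simp flip: mult)
  then show ?thesis by (simp add: inverse_unique)
qed simp

lemma av_divide: "av (x / y) = av x / av y"
  by (simp add: divide_inverse mult av_inverse)

lemma av_power: "av (x ^ n) = av x ^ n"
  by (induction n) (auto simp: mult)

lemma av_minus [simp]: "av (- x) = av x"
proof -
  have "av (-1) * av (-1) = 1" by (simp flip: mult)
  then have "av (-1) = 1"
    using nonneg[of "-1"] by (metis abs_of_nonneg abs_square_eq_1 power2_eq_square)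
  then show ?thesis using mult[of "-1" x] by simp
qed

section \<open>The topology of Q_p and the topology \<open>tau\<close>\<close>

lemma openin_Qp_top:
  "openin (Qp_top av) U \<longleftrightarrow> (\<forall>x\<in>U. \<exists>e>0. \<forall>y. av (y - x) < e \<longrightarrow> y \<in> U)"
proof -
  have "istopology (\<lambda>U. \<forall>x\<in>U. \<exists>e>0. \<forall>y. av (y - x) < e \<longrightarrow> y \<in> U)"
    unfolding istopology_def
  proof (intro conjI allI impI ballI)
    fix S T x
    assume S: "\<forall>x\<in>S. \<exists>e>0. \<forall>y. av (y - x) < e \<longrightarrow> y \<in> S"
      and T: "\<forall>x\<in>T. \<exists>e>0. \<forall>y. av (y - x) < e \<longrightarrow> y \<in> T" and x: "x \<in> S \<inter> T"
    obtain d e where "d > 0" "\<forall>y. av (y - x) < d \<longrightarrow> y \<in> S" "e > 0" "\<forall>y. av (y - x) < e \<longrightarrow> y \<in> T"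
      using S T x by blast
    then show "\<exists>e>0. \<forall>y. av (y - x) < e \<longrightarrow> y \<in> S \<inter> T"
      by (intro exI[of _ "min d e"]) auto
  next
    fix \<U> x
    assume *: "\<forall>U\<in>\<U>. \<forall>x\<in>U. \<exists>e>0. \<forall>y. av (y - x) < e \<longrightarrow> y \<in> U" and "x \<in> \<Union>\<U>"
    then obtain U where "U \<in> \<U>" "x \<in> U" by blast
    with * obtain e where "e > 0" "\<forall>y. av (y - x) < e \<longrightarrow> y \<in> U" by blast
    with \<open>U \<in> \<U>\<close> show "\<exists>e>0. \<forall>y. av (y - x) < e \<longrightarrow> y \<in> \<Union>\<U>" by blast
  qed
  then show ?thesis unfolding Qp_top_def by (simp add: topology_inverse')
qed

lemma topspace_Qp_top [simp]: "topspace (Qp_top av) = UNIV"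
proof -
  have "openin (Qp_top av) UNIV" unfolding openin_Qp_top by (auto intro: exI[of _ 1])
  then show ?thesis using openin_subset by blast
qed

text \<open>By the strong triangle inequality, the open ball of radius 1 around any point of the
  closed unit ball stays inside it.\<close>

lemma openin_unit_ball: "openin (Qp_top av) {x. av x \<le> 1}"
  unfolding openin_Qp_top
proof (intro ballI exI[of _ 1] conjI allI impI)
  fix x y assume "x \<in> {x. av x \<le> 1}" "av (y - x) < 1"
  then show "y \<in> {x. av x \<le> 1}" using ultra[of "y - x" x] by simp
qed simp

text \<open>If \<open>y\<close> is closer to \<open>x\<close> than \<open>av x\<close>, the strong
  triangle inequality forces \<open>av y\<close> to be at least \<open>av x\<close>. Since
  \<open>r\<close> is nonnegative, the radius \<open>av x\<close> is positive.\<close>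

lemma openin_outside_ball:
  assumes "r \<ge> 0"
  shows "openin (Qp_top av) {x. av x > r}"
  unfolding openin_Qp_top
proof
  fix x assume x: "x \<in> {x. av x > r}"
  have "y \<in> {x. av x > r}" if "av (y - x) < av x" for y
  proof -
    have "av (x - y) < av x" using that av_minus[of "y - x"] by simp
    then show ?thesis using ultra[of "x - y" y] x by auto
  qed
  then show "\<exists>e>0. \<forall>y. av (y - x) < e \<longrightarrow> y \<in> {x. av x > r}"
    using x assms by (intro exI[of _ "av x"]) auto
qed

lemma box_set_subset_QpX: "finite P \<Longrightarrow> box_set av P \<subseteq> QpX av"
  unfolding box_set_def QpX_def by (auto elim!: finite_subset[rotated])

lemma openin_tau:
  fixes A :: "('x \<Rightarrow> 'k) set"
  shows "openin (tau av) A \<longleftrightarrow> A \<subseteq> QpX av \<and> (\<forall>P. finite P \<longrightarrow>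
     openin (subtopology (product_topology (\<lambda>i. Qp_top av) UNIV) (box_set av P)) (A \<inter> box_set av P))"
proof -
  have "istopology (\<lambda>A :: ('x \<Rightarrow> 'k) set. A \<subseteq> QpX av \<and> (\<forall>P. finite P \<longrightarrow>
     openin (subtopology (product_topology (\<lambda>i. Qp_top av) UNIV) (box_set av P)) (A \<inter> box_set av P)))"
    unfolding istopology_def
  proof (intro conjI allI impI)
    fix S T :: "('x \<Rightarrow> 'k) set" and P :: "'x set"
    assume "S \<subseteq> QpX av \<and> (\<forall>P. finite P \<longrightarrow>
        openin (subtopology (product_topology (\<lambda>i. Qp_top av) UNIV) (box_set av P)) (S \<inter> box_set av P))"
      "T \<subseteq> QpX av \<and> (\<forall>P. finite P \<longrightarrow>
        openin (subtopology (product_topology (\<lambda>i. Qp_top av) UNIV) (box_set av P)) (T \<inter> box_set av P))"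
      "finite P"
    then have "openin (subtopology (product_topology (\<lambda>i. Qp_top av) UNIV) (box_set av P))
        ((S \<inter> box_set av P) \<inter> (T \<inter> box_set av P))" by blast
    then show "openin (subtopology (product_topology (\<lambda>i. Qp_top av) UNIV) (box_set av P))
        (S \<inter> T \<inter> box_set av P)" by (simp add: Int_ac)
  next
    fix \<U> :: "('x \<Rightarrow> 'k) set set" and P :: "'x set"
    assume "\<forall>U\<in>\<U>. U \<subseteq> QpX av \<and> (\<forall>P. finite P \<longrightarrow>
        openin (subtopology (product_topology (\<lambda>i. Qp_top av) UNIV) (box_set av P)) (U \<inter> box_set av P))"
      "finite P"
    then have "openin (subtopology (product_topology (\<lambda>i. Qp_top av) UNIV) (box_set av P))
        (\<Union>U\<in>\<U>. U \<inter> box_set av P)" by (intro openin_Union) auto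
    then show "openin (subtopology (product_topology (\<lambda>i. Qp_top av) UNIV) (box_set av P))
        (\<Union>\<U> \<inter> box_set av P)" by (simp only: Int_Union2)
  qed blast+
  then show ?thesis unfolding tau_def by (simp add: topology_inverse')
qed

lemma topspace_tau [simp]: "topspace (tau av) = QpX av"
proof -
  have "openin (tau av) (QpX av)"
    unfolding openin_tau
    by (simp add: box_set_subset_QpX Int_absorb1 openin_subtopology_refl)
  moreover have "topspace (tau av) \<subseteq> QpX av" using openin_tau openin_topspace by blast
  ultimately show ?thesis using openin_subset by blast
qed

lemma openin_product_coordinate:
  assumes "openin (Qp_top av) U"
  shows "openin (product_topology (\<lambda>i. Qp_top av) UNIV) {\<xi>. \<xi> j \<in> U}"
proof -
  have "continuous_map (product_topology (\<lambda>i. Qp_top av) UNIV) (Qp_top av) (\<lambda>\<xi>. \<xi> j)"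
    by (rule continuous_map_product_projection) simp
  from openin_continuous_map_preimage[OF this assms] show ?thesis by simp
qed

lemma openin_tau_coordinate:
  fixes j :: 'x
  assumes "openin (Qp_top av) U"
  shows "openin (tau av) {\<xi> \<in> QpX av. \<xi> j \<in> U}"
  unfolding openin_tau
proof (intro conjI allI impI)
  fix P :: "'x set" assume "finite P"
  then have "{\<xi> \<in> QpX av. \<xi> j \<in> U} \<inter> box_set av P = {\<xi>. \<xi> j \<in> U} \<inter> box_set av P"
    using box_set_subset_QpX by blast
  then show "openin (subtopology (product_topology (\<lambda>i. Qp_top av) UNIV) (box_set av P))
      ({\<xi> \<in> QpX av. \<xi> j \<in> U} \<inter> box_set av P)"
    using openin_subtopology_Int[OF openin_product_coordinate[OF assms]] by simp
qed blast

text \<open>Inside the box of a finite \<open>Q\<close>, coordinates outside \<open>Q\<close> are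
  integral already. Lying in the box of \<open>P\<close> then restricts only the finitely many
  coordinates in \<open>Q\<close> outside \<open>P\<close>, each to the open unit ball.\<close>

lemma openin_tau_box_set:
  fixes P :: "'x set"
  assumes "finite P"
  shows "openin (tau av) (box_set av P)"
  unfolding openin_tau
proof (intro conjI allI impI box_set_subset_QpX assms)
  fix Q :: "'x set" assume "finite Q"
  define W where "W = (\<Inter>j\<in>Q. {\<xi> :: 'x \<Rightarrow> 'k. \<xi> j \<in> (if j \<in> P then UNIV else {x. av x \<le> 1})})"
  have "openin (product_topology (\<lambda>i. Qp_top av) UNIV) W"
  proof (cases "Q = {}")
    case True
    then show ?thesis
      using openin_topspace[of "product_topology (\<lambda>i::'x. Qp_top av) UNIV"] by (simp add: W_def)
  next
    case False
    have "openin (Qp_top av) UNIV" using openin_topspace[of "Qp_top av"] by simp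
    then show ?thesis unfolding W_def using \<open>finite Q\<close> False openin_unit_ball
      by (intro openin_Inter) (auto intro!: openin_product_coordinate split: if_splits)
  qed
  moreover have "box_set av P \<inter> box_set av Q = W \<inter> box_set av Q"
    by (auto simp: W_def box_set_def split: if_splits)
  ultimately show "openin (subtopology (product_topology (\<lambda>i. Qp_top av) UNIV) (box_set av Q))
      (box_set av P \<inter> box_set av Q)"
    using openin_subtopology_Int by metis
qed

lemma box_set_mono: "P \<subseteq> Q \<Longrightarrow> box_set av P \<subseteq> box_set av Q"
  unfolding box_set_def by blast

text \<open>The boxes of finite sets are an open cover of the whole space. A finite subcover lies in
  the single box of the union of its index sets.\<close>

lemma compactin_tau_subset_box:
  assumes "compactin (tau av) K"
  shows "\<exists>P. finite P \<and> K \<subseteq> box_set av P"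
proof -
  have K: "K \<subseteq> QpX av" using compactin_subset_topspace[OF assms] by simp
  have "K \<subseteq> \<Union> (box_set av ` {P. finite P})"
  proof
    fix \<xi> assume "\<xi> \<in> K"
    then have "finite {i. av (\<xi> i) > 1}" using K unfolding QpX_def by blast
    moreover have "\<xi> \<in> box_set av {i. av (\<xi> i) > 1}" by (simp add: box_set_def)
    ultimately show "\<xi> \<in> \<Union> (box_set av ` {P. finite P})" by blast
  qed
  moreover have "openin (tau av) U" if "U \<in> box_set av ` {P. finite P}" for U
    using that openin_tau_box_set by blast
  ultimately obtain \<F>
    where \<F>: "finite \<F>" "\<F> \<subseteq> box_set av ` {P. finite P}" "K \<subseteq> \<Union>\<F>"
    using compactinD[OF assms] by metis
  then obtain \<P> where \<P>: "finite \<P>" "\<P> \<subseteq> {P. finite P}" "\<F> = box_set av ` \<P>"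
    using finite_subset_image by metis
  then have "K \<subseteq> box_set av (\<Union>\<P>)"
    using \<F>(3) box_set_mono[OF Union_upper] by blast
  with \<P> show ?thesis by blast
qed

text \<open>On the unit ball \<open>box_set av {}\<close>, \<open>tau\<close> induces the product
  topology, where a basic neighbourhood restricts finitely many coordinates; all others may be set
  to 0.\<close>

lemma finite_support_dense:
  assumes "openin (tau av) A" "\<zeta> \<in> A" "\<zeta> \<in> box_set av {}"
  shows "\<exists>\<eta>\<in>A. \<eta> \<in> box_set av {} \<and> finite {i. \<eta> i \<noteq> 0}"
proof -
  obtain T where T: "openin (product_topology (\<lambda>i. Qp_top av) UNIV) T"
    and AT: "A \<inter> box_set av {} = T \<inter> box_set av {}"
    using assms(1) unfolding openin_tau openin_subtopology by blast
  have "\<zeta> \<in> T" using assms AT by blast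
  then obtain U where U: "finite {i. U i \<noteq> UNIV}" "\<zeta> \<in> PiE UNIV U" "PiE UNIV U \<subseteq> T"
    using T unfolding openin_product_topology_alt by fastforce
  define \<eta> where "\<eta> i = (if U i = UNIV then 0 else \<zeta> i)" for i
  have "\<eta> \<in> T" using U by (auto simp: \<eta>_def PiE_iff intro!: subsetD[OF U(3)])
  moreover have "\<eta> \<in> box_set av {}" using assms(3) by (auto simp: \<eta>_def box_set_def)
  moreover have "finite {i. \<eta> i \<noteq> 0}"
    by (rule finite_subset[OF _ U(1)]) (auto simp: \<eta>_def)
  ultimately show ?thesis using AT by blast
qed

section \<open>Compact operators on the unit ball\<close>

lemma bounded_ops_maps: "T \<in> bounded_ops av \<Longrightarrow> \<xi> \<in> QpX av \<Longrightarrow> T \<xi> \<in> QpX av"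
  unfolding bounded_ops_def by blast

lemma bounded_ops_scale:
  "T \<in> bounded_ops av \<Longrightarrow> av a \<le> 1 \<Longrightarrow> \<xi> \<in> QpX av \<Longrightarrow> T (\<lambda>i. a * \<xi> i) = (\<lambda>i. a * T \<xi> i)"
  unfolding bounded_ops_def by blast

text \<open>The point is that one finite \<open>P\<close> serves all \<zeta> at once. It comes from
  a box containing the image of vectors enlarged by the inverse of \<open>r\<close>; scaling back
  turns the bound 1 off \<open>P\<close> into \<open>av r\<close>.\<close>

lemma compact_op_unit_ball:
  fixes T :: "('x \<Rightarrow> 'k) \<Rightarrow> 'x \<Rightarrow> 'k"
  assumes T: "T \<in> compact_ops av" and r: "r \<noteq> 0" "av r \<le> 1"
  shows "\<exists>P. finite P \<and> (\<forall>\<zeta>\<in>box_set av {}. \<forall>j. j \<notin> P \<longrightarrow> av (T \<zeta> j) \<le> av r)"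
proof -
  have Tb: "T \<in> bounded_ops av" using T by (simp add: compact_ops_def)
  \<comment> \<open>Finite support keeps \<open>B\<close> inside \<open>QpX av\<close>: a unit-ball
    vector divided by \<open>r\<close> may have infinitely many coordinates of absolute value above
    1.\<close>
  define B :: "('x \<Rightarrow> 'k) set"
    where "B = {\<xi>. finite {i. \<xi> i \<noteq> 0} \<and> (\<forall>i. av (\<xi> i) \<le> inverse (av r))}"
  have B: "B \<subseteq> QpX av"
    unfolding B_def QpX_def by (auto elim!: finite_subset[rotated])
  have "qnorm av \<xi> \<le> inverse (av r)" if "\<xi> \<in> B" for \<xi>
    using that unfolding qnorm_def B_def by (auto intro!: cSUP_least)
  then have "compactin (tau av) (tau av closure_of (T ` B))"
    using T B unfolding compact_ops_def by blast
  then obtain P where P: "finite P" "tau av closure_of (T ` B) \<subseteq> box_set av P"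
    using compactin_tau_subset_box by blast
  have "T ` B \<subseteq> topspace (tau av)" using B bounded_ops_maps[OF Tb] by auto
  then have TB: "T ` B \<subseteq> box_set av P" using P(2) closure_of_subset by blast
  have fin: "av (T \<eta> j) \<le> av r"
    if \<eta>: "\<eta> \<in> box_set av {}" "finite {i. \<eta> i \<noteq> 0}" and j: "j \<notin> P" for \<eta> j
  proof -
    define \<theta> where "\<theta> i = inverse r * \<eta> i" for i
    have "\<theta> \<in> B"
      using \<eta> r nonneg[of r] unfolding B_def \<theta>_def box_set_def
      by (auto simp: mult av_inverse mult_left_le)
    moreover have "\<eta> = (\<lambda>i. r * \<theta> i)" using r by (simp add: \<theta>_def fun_eq_iff)
    ultimately have "T \<eta> = (\<lambda>i. r * T \<theta> i)"
      using bounded_ops_scale[OF Tb r(2)] B by blast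
    moreover have "av (T \<theta> j) \<le> 1" using TB \<open>\<theta> \<in> B\<close> j unfolding box_set_def by blast
    ultimately show ?thesis using nonneg[of r] by (simp add: mult mult_left_le)
  qed
  have "av (T \<zeta> j) \<le> av r" if \<zeta>: "\<zeta> \<in> box_set av {}" and j: "j \<notin> P" for \<zeta> j
  proof (rule ccontr)
    assume gt: "\<not> av (T \<zeta> j) \<le> av r"
    \<comment> \<open>The set where the bound fails at \<open>j\<close> is open by continuity of
      \<open>T\<close>. If it contained \<zeta>, it would contain a finitely supported vector of the
      unit ball, contradicting \<open>fin\<close>.\<close>
    define A where "A = {\<xi> \<in> QpX av. T \<xi> \<in> {\<xi> \<in> QpX av. \<xi> j \<in> {x. av x > av r}}}"
    have "continuous_map (tau av) (tau av) T" using Tb by (simp add: bounded_ops_def)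
    from openin_continuous_map_preimage[OF this openin_tau_coordinate[OF openin_outside_ball[OF nonneg]]]
    have A: "openin (tau av) A" unfolding A_def by simp
    have "\<zeta> \<in> QpX av" by (rule subsetD[OF box_set_subset_QpX[OF finite.emptyI] \<zeta>])
    moreover from this have "T \<zeta> \<in> QpX av" by (rule bounded_ops_maps[OF Tb])
    ultimately have "\<zeta> \<in> A" using gt unfolding A_def by simp
    then obtain \<eta> where "\<eta> \<in> A" "\<eta> \<in> box_set av {}" "finite {i. \<eta> i \<noteq> 0}"
      using finite_support_dense[OF A _ \<zeta>] by blast
    then show False using fin[OF _ _ j] unfolding A_def by force
  qed
  with P show ?thesis by blast
qed

text \<open>The scalar \<open>t\<close> stands for \<open>p\<close> here and below. Only finitely
  many coordinates exceed 1, so all are bounded by some \<open>M\<close>, and a high power of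
  \<open>t\<close> beats \<open>M\<close>.\<close>

lemma QpX_scale_into_unit_ball:
  assumes "0 < av t" "av t < 1" "\<xi> \<in> QpX av"
  shows "\<exists>s. s \<noteq> 0 \<and> av s \<le> 1 \<and> (\<lambda>i. s * \<xi> i) \<in> box_set av {}"
proof -
  \<comment> \<open>The inserted 1 keeps the set nonempty and makes \<open>M\<close> bound the
    integral coordinates too.\<close>
  define M where "M = Max (insert 1 ((\<lambda>i. av (\<xi> i)) ` {i. av (\<xi> i) > 1}))"
  have fin: "finite {i. av (\<xi> i) > 1}" using assms unfolding QpX_def by blast
  have M1: "M \<ge> 1" unfolding M_def using fin by (intro Max_ge) auto
  have M: "av (\<xi> i) \<le> M" for i
  proof (cases "av (\<xi> i) > 1")
    case True
    then show ?thesis unfolding M_def using fin by (intro Max_ge) auto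
  next
    case False
    then show ?thesis using M1 by linarith
  qed
  obtain n where n: "av t ^ n < inverse M"
    using real_arch_pow_inv[of "inverse M" "av t"] assms M1 by auto
  have "av (t ^ n * \<xi> i) \<le> 1" for i
  proof -
    have "av (t ^ n * \<xi> i) \<le> inverse M * M"
      unfolding mult av_power using n M[of i] nonneg M1 by (intro mult_mono) auto
    then show ?thesis using M1 by simp
  qed
  then show ?thesis
    using assms by (intro exI[of _ "t ^ n"]) (auto simp: av_power box_set_def power_le_one)
qed

text \<open>The coordinates of \<open>T \<xi>\<close> tend to 0, which is what allows division by
  \<open>r\<close> without leaving \<open>QpX av\<close>.\<close>

lemma compact_op_image_decays:
  assumes t: "0 < av t" "av t < 1"
    and T: "T \<in> compact_ops av" and r: "r \<noteq> 0" "av r \<le> 1" and \<xi>: "\<xi> \<in> QpX av"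
  shows "finite {j. av (T \<xi> j) > av r}"
proof -
  have Tb: "T \<in> bounded_ops av" using T by (simp add: compact_ops_def)
  obtain s where s: "s \<noteq> 0" "av s \<le> 1" "(\<lambda>i. s * \<xi> i) \<in> box_set av {}"
    using QpX_scale_into_unit_ball[OF t \<xi>] by blast
  \<comment> \<open>The threshold is \<open>s * r\<close> because the bound obtained for
    \<open>T\<close> of the shrunken vector is afterwards divided by \<open>av s\<close>.\<close>
  have "av (s * r) \<le> 1" using s r nonneg by (simp add: mult mult_le_one)
  then obtain P where P: "finite P" "\<And>j. j \<notin> P \<Longrightarrow> av (T (\<lambda>i. s * \<xi> i) j) \<le> av (s * r)"
    using compact_op_unit_ball[OF T, of "s * r"] s r by auto
  have "av (T \<xi> j) \<le> av r" if "j \<notin> P" for j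
    using P(2)[OF that] bounded_ops_scale[OF Tb s(2) \<xi>] av_pos[OF s(1)] by (simp add: mult)
  then have "{j. av (T \<xi> j) > av r} \<subseteq> P" by (auto simp flip: not_le)
  then show ?thesis using P(1) finite_subset by blast
qed

section \<open>The image of a compact idempotent\<close>

text \<open>\<open>T\<close> is linear only over integral scalars. For larger \<open>c\<close>,
  decay of \<open>v = T v\<close> keeps \<open>w = c v\<close> in \<open>QpX av\<close>, and
  applying \<open>T\<close> to \<open>v = r w\<close> with \<open>r\<close> the inverse of
  \<open>c\<close> gives \<open>r T w = r w\<close>, so \<open>T\<close> fixes
  \<open>w\<close>.\<close>

lemma compact_idempotent_image_scale:
  assumes t: "0 < av t" "av t < 1"
    and T: "T \<in> compact_ops av" and idem: "\<forall>\<xi>\<in>QpX av. T (T \<xi>) = T \<xi>"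
    and v: "v \<in> T ` QpX av"
  shows "(\<lambda>i. c * v i) \<in> T ` QpX av"
proof -
  have Tb: "T \<in> bounded_ops av" using T by (simp add: compact_ops_def)
  have vX: "v \<in> QpX av" and Tv: "T v = v"
    using v idem bounded_ops_maps[OF Tb] by auto
  define w where "w = (\<lambda>i. c * v i)"
  show ?thesis
  proof (cases "av c \<le> 1")
    case True
    have "w \<in> QpX av"
    proof -
      have "av (w i) \<le> av (v i)" for i
        using True nonneg[of "v i"] unfolding w_def mult by (simp add: mult_left_le_one_le nonneg)
      then have "{i. av (w i) > 1} \<subseteq> {i. av (v i) > 1}" by (auto intro: less_le_trans)
      then show ?thesis using vX unfolding QpX_def by (auto intro: finite_subset)
    qed
    moreover have "T w = w" using bounded_ops_scale[OF Tb True vX] Tv by (simp add: w_def)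
    ultimately show ?thesis using image_eqI[of w T w "QpX av"] by (simp add: w_def)
  next
    case False
    define r where "r = inverse c"
    have c0: "c \<noteq> 0" using False by auto
    then have r: "r \<noteq> 0" "av r \<le> 1" "av c > 0"
      using False av_pos[OF c0] by (auto simp: r_def av_inverse inverse_le_1_iff)
    have "{j. av (w j) > 1} = {j. av (T v j) > av r}"
      using r(3) by (auto simp: w_def r_def Tv mult av_divide field_simps)
    then have "w \<in> QpX av"
      using compact_op_image_decays[OF t T r(1,2) vX] unfolding QpX_def by simp
    moreover have v_eq: "v = (\<lambda>i. r * w i)" using c0 by (simp add: w_def r_def fun_eq_iff)
    have "(\<lambda>i. r * T w i) = (\<lambda>i. r * w i)"
      using bounded_ops_scale[OF Tb r(2) \<open>w \<in> QpX av\<close>] Tv v_eq by metis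
    then have "T w = w" using r(1) by (simp add: fun_eq_iff)
    ultimately show ?thesis using image_eqI[of w T w "QpX av"] by (simp add: w_def)
  qed
qed

lemma bounded_ops_image_add:
  assumes T: "T \<in> bounded_ops av" and "v \<in> T ` QpX av" "w \<in> T ` QpX av"
  shows "(\<lambda>i. v i + w i) \<in> T ` QpX av"
proof -
  obtain \<xi> \<eta> where \<xi>: "\<xi> \<in> QpX av" "v = T \<xi>" and \<eta>: "\<eta> \<in> QpX av" "w = T \<eta>" using assms by blast
  have "{i. av (\<xi> i + \<eta> i) > 1} \<subseteq> {i. av (\<xi> i) > 1} \<union> {i. av (\<eta> i) > 1}"
    using less_le_trans[OF _ ultra] by (auto simp: less_max_iff_disj)
  then have "(\<lambda>i. \<xi> i + \<eta> i) \<in> QpX av"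
    using \<xi>(1) \<eta>(1) unfolding QpX_def mem_Collect_eq by (rule finite_subset[OF _ finite_UnI])
  moreover have "T (\<lambda>i. \<xi> i + \<eta> i) = (\<lambda>i. v i + w i)"
    using T \<xi> \<eta> unfolding bounded_ops_def by blast
  ultimately show ?thesis using image_eqI[of _ T "\<lambda>i. \<xi> i + \<eta> i" "QpX av"] by simp
qed

lemma compact_idempotent_inj_restriction:
  assumes t: "0 < av t" "av t < 1"
    and T: "T \<in> compact_ops av" and idem: "\<forall>\<xi>\<in>QpX av. T (T \<xi>) = T \<xi>"
  shows "\<exists>P. finite P \<and> (\<forall>v\<in>T ` QpX av. (\<forall>i\<in>P. v i = 0) \<longrightarrow> (\<forall>i. v i = 0))"
proof -
  have Tb: "T \<in> bounded_ops av" using T by (simp add: compact_ops_def)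
  have t0: "t \<noteq> 0" using t by auto
  obtain P where P: "finite P"
    and dec: "\<And>\<zeta> j. \<zeta> \<in> box_set av {} \<Longrightarrow> j \<notin> P \<Longrightarrow> av (T \<zeta> j) \<le> av t"
    using compact_op_unit_ball[OF T t0] t by auto
  \<comment> \<open>Since \<open>T v = v\<close>, each coordinate is at most \<open>av t\<close>:
    off \<open>P\<close> by \<open>dec\<close>, on \<open>P\<close> because it is 0. Hence
    \<open>v\<close> can be divided by \<open>t\<close> within the unit ball.\<close>
  have step: "(\<lambda>i. inverse t * v i) \<in> box_set av {}"
    if v: "v \<in> T ` QpX av" "v \<in> box_set av {}" "\<forall>i\<in>P. v i = 0" for v
  proof -
    have "T v = v" using v(1) idem by auto
    then have "av (v i) \<le> av t" for i using dec[OF v(2), of i] v(3) t by (cases "i \<in> P") auto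
    then show ?thesis using t by (simp add: box_set_def av_divide field_simps)
  qed
  have "\<forall>i. v i = 0" if v: "v \<in> T ` QpX av" "\<forall>i\<in>P. v i = 0" for v
  proof
    fix i
    have "v \<in> QpX av" using v(1) bounded_ops_maps[OF Tb] by blast
    then obtain s where s: "s \<noteq> 0" "(\<lambda>i. s * v i) \<in> box_set av {}"
      using QpX_scale_into_unit_ball[OF t] by blast
    \<comment> \<open>The quotients stay in the image, which is closed under all scalars, and still
      vanish on \<open>P\<close>, so \<open>step\<close> can be iterated.\<close>
    have "(\<lambda>i. inverse t ^ n * (s * v i)) \<in> box_set av {}" for n
    proof (induction n)
      case (Suc n)
      have "(\<lambda>i. inverse t ^ n * (s * v i)) \<in> T ` QpX av"
        using compact_idempotent_image_scale[OF t T idem v(1), of "inverse t ^ n * s"]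
        by (simp add: ac_simps)
      from step[OF this Suc] v(2) show ?case by (simp add: ac_simps)
    qed (use s in simp)
    then have le: "av (s * v i) \<le> av t ^ n" for n
      using t by (simp add: box_set_def mult av_power av_divide field_simps)
    have "av (s * v i) \<le> 0"
      by (rule LIMSEQ_le_const[OF LIMSEQ_realpow_zero]) (use t le in auto)
    then show "v i = 0" using nonneg[of "s * v i"] s(1) by (simp add: eq_0_iff flip: order_eq_iff)
  qed
  with P show ?thesis by blast
qed

end

section \<open>The absolute value of \<open>p\<close> and the conclusion\<close>

lemma padic_abs_rat_self:
  assumes "prime p"
  shows "padic_abs_rat p (of_nat p) = inverse (real p)"
proof -
  have "quotient_of (of_nat p) = (int p, 1)"
    using quotient_of_int[of "int p"] by simp
  moreover have "p > 1" using assms prime_gt_1_nat by blast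
  ultimately show ?thesis
    by (simp add: padic_abs_rat_def padic_val_rat_def powr_minus multiplicity_self)
qed

theorem theorem3p10:
  fixes p :: nat and av :: "'k::field_char_0 \<Rightarrow> real"
    and e :: "('x::countable \<Rightarrow> 'k) \<Rightarrow> ('x \<Rightarrow> 'k)"
  assumes "prime p"
    and "is_Qp p av"
    and "e \<in> compact_ops av"
    and "\<forall>\<xi>\<in>QpX av. e (e \<xi>) = e \<xi>"
  shows "(\<forall>\<xi>\<in>e ` QpX av. \<forall>\<eta>\<in>e ` QpX av. (\<lambda>i. \<xi> i + \<eta> i) \<in> e ` QpX av)
       \<and> (\<forall>c. \<forall>\<xi>\<in>e ` QpX av. (\<lambda>i. c * \<xi> i) \<in> e ` QpX av)
       \<and> (\<exists>F. finite F \<and> F \<subseteq> e ` QpX av \<and>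
            (\<forall>\<xi>\<in>e ` QpX av. \<exists>c. \<forall>i. \<xi> i = (\<Sum>f\<in>F. c f * f i)))"
proof -
  interpret nonarch_abs av
    by unfold_locales (use assms(2) in \<open>simp_all add: is_Qp_def\<close>)
  have "av (of_rat q) = padic_abs_rat p q" for q
    using assms(2) by (simp add: is_Qp_def)
  from this[of "of_nat p"] have "av (of_nat p) = inverse (real p)"
    by (simp add: padic_abs_rat_self[OF assms(1)])
  \<comment> \<open>The prime itself is the scalar \<open>t\<close> of the preceding lemmas.\<close>
  then have t: "0 < av (of_nat p)" "av (of_nat p) < 1"
    using prime_gt_1_nat[OF assms(1)] by (simp_all add: inverse_less_1_iff)
  have "e \<in> bounded_ops av" using assms(3) by (simp add: compact_ops_def)
  note add = bounded_ops_image_add[OF this]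
  note scale = compact_idempotent_image_scale[OF t assms(3,4)]
  obtain P where P: "finite P" "\<forall>v\<in>e ` QpX av. (\<forall>i\<in>P. v i = 0) \<longrightarrow> (\<forall>i. v i = 0)"
    using compact_idempotent_inj_restriction[OF t assms(3,4)] by blast
  show ?thesis
  proof (intro conjI ballI allI add scale)
    show "\<exists>F. finite F \<and> F \<subseteq> e ` QpX av \<and>
        (\<forall>\<xi>\<in>e ` QpX av. \<exists>c. \<forall>i. \<xi> i = (\<Sum>f\<in>F. c f * f i))"
      by (rule finite_spanning_set_of_inj_restriction[OF P(1) add scale]) (use P(2) in blast)+
  qed
qed

end
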